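(* Let $(V,\omega)$ be a simple VOA of strong CFT type over $\mathbb{K}$. Then all the elements of $CV_{sCFT}$ are conjugate under $\mathrm{Aut}\,V$; that is, for all $a,b\in CV_{sCFT}$ there exists $f\in\mathrm{Aut}\,V$ with $f(a)=b$.
   Context: The base field $\mathbb{K}$ is $\mathbb{R}$ or $\mathbb{C}$. For a vertex algebra $V$ over $\mathbb{K}$ with vacuum vector $\mathbf{1}$, $a(n)b$ denotes the $n$-th product ($n\in\mathbb{Z}$), $a(n)\in\mathrm{End}\,V$, and $Ta=a(-2)\mathbf{1}$. A $\mathbb{Z}$-graded vertex algebra is a vertex algebra $V=\bigoplus_{n\in\mathbb{Z}}V_n$ with $V_n(k)V_m\subset V_{n+m-k-1}$ and $\mathbf{1}\in V_0$. A $\mathbb{Z}$-graded conformal vertex algebra $(V,\omega)$ is a $\mathbb{Z}$-graded vertex algebra with a distinguished $\omega\in V_2$ such that the operators $L(n)=\omega(n+1)$ satisfy $[L(n),L(m)]=(n-m)L(n+m)+\frac{1}{12}\delta_{n+m,0}(n^3-n)c$ for some $c\in\mathbb{K}$, $L(0)v=nv$ for $v\in V_n$, and $L(-1)=T$. It is a VOA of CFT type if $V=\bigoplus_{n\in\mathbb{N}}V_n$ (with $\mathbb{N}=\{0,1,2,\dots\}$), $\dim V_n<\infty$ for all $n$, and $V_0=\mathbb{K}\mathbf{1}$. It is a VOA of strong CFT type if moreover $L(1)V_1=0$. Simple means that $V$ has no nontrivial proper ideals. $\mathrm{Aut}\,V$ is the group of vertex algebra automorphisms of $V$: linear isomorphisms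 $f$ with $f(a(n)b)=f(a)(n)f(b)$ for all $a,b,n$ and $f(\mathbf{1})=\mathbf{1}$ (not required to fix $\omega$). $CV_{sCFT}$ is the set of conformal vectors of strong CFT type of $V$, i.e. of $a\in V$ such that $(V,a)$, with grading $V=\bigoplus_n V_n^a$, $V_n^a=\{v\in V\mid a(1)v=nv\}$, is a VOA of strong CFT type. *)

theory Defs
  imports Complex_Main "HOL-Library.Groups_Big_Fun"
begin

text \<open>
  The base field: a type of this class is a field isomorphic to the reals or to the complex numbers.
  Characteristic 0 is part of the sort only so that generalised binomial coefficients are
  available; it is implied by the class axiom.
\<close>

class real_or_complex = field_char_0 +
  assumes iso_real_or_complex:
    "(\<exists>h :: 'a \<Rightarrow> real. bij h \<and> h 1 = 1 \<and>
        (\<forall>x y. h (x + y) = h x + h y) \<and> (\<forall>x y. h (x * y) = h x * h y)) \<or>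
     (\<exists>h :: 'a \<Rightarrow> complex. bij h \<and> h 1 = 1 \<and>
        (\<forall>x y. h (x + y) = h x + h y) \<and> (\<forall>x y. h (x * y) = h x * h y))"

instance real :: real_or_complex
  by standard (rule disjI1, rule exI[of _ "\<lambda>x. x"], simp add: bij_id[unfolded id_def])

instance complex :: real_or_complex
  by standard (rule disjI2, rule exI[of _ "\<lambda>x. x"], simp add: bij_id[unfolded id_def])

text \<open>
  \<open>Y a n b\<close> is the product $a(n)b$. The last axiom is the Borcherds identity
  \[ \sum_{i \ge 0} {p \choose i} (a(r+i)b)(p+q-i)c
     = \sum_{i \ge 0} (-1)^i {r \choose i}
        \bigl(a(p+r-i)\,b(q+i)c - (-1)^r\, b(q+r-i)\,a(p+i)c\bigr). \]
  By truncation only finitely many summands are nonzero, so that \<open>Sum_any\<close> is the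
  intended sum. The axiom on \<open>Y vac\<close> follows from the others.
\<close>

locale vertex_algebra = vector_space scale
  for scale :: "'k::field_char_0 \<Rightarrow> 'v::ab_group_add \<Rightarrow> 'v" +
  fixes Y :: "'v \<Rightarrow> int \<Rightarrow> 'v \<Rightarrow> 'v"
    and vac :: 'v
  assumes linear_left: "Vector_Spaces.linear scale scale (\<lambda>a. Y a n b)"
    and linear_right: "Vector_Spaces.linear scale scale (\<lambda>b. Y a n b)"
    and truncation: "\<exists>N. \<forall>n\<ge>N. Y a n b = 0"
    and creation: "Y a (-1) vac = a"
    and creation_nonneg: "n \<ge> 0 \<Longrightarrow> Y a n vac = 0"
    and vacuum: "Y vac n a = (if n = -1 then a else 0)"
    and borcherds:
      "Sum_any (\<lambda>i::nat. scale (of_int p gchoose i) (Y (Y a (r + int i) b) (p + q - int i) c))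
       = Sum_any (\<lambda>i::nat. scale ((-1) ^ i * (of_int r gchoose i))
           (Y a (p + r - int i) (Y b (q + int i) c)
            - scale ((-1) powi r) (Y b (q + r - int i) (Y a (p + int i) c))))"
begin

definition T :: "'v \<Rightarrow> 'v" where
  "T a = Y a (-2) vac"

definition is_ideal :: "'v set \<Rightarrow> bool" where
  "is_ideal I \<longleftrightarrow> subspace I \<and> (\<forall>a. \<forall>n. \<forall>v\<in>I. Y a n v \<in> I \<and> Y v n a \<in> I)"

definition is_simple :: bool where
  "is_simple \<longleftrightarrow> (\<forall>I. is_ideal I \<longrightarrow> I = {0} \<or> I = UNIV)"

definition Aut :: "('v \<Rightarrow> 'v) set" where
  "Aut = {f. Vector_Spaces.linear scale scale f \<and> bij f \<and>
             (\<forall>a n b. f (Y a n b) = Y (f a) n (f b)) \<and> f vac = vac}"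

end

locale graded_vertex_algebra = vertex_algebra scale Y vac
  for scale :: "'k::field_char_0 \<Rightarrow> 'v::ab_group_add \<Rightarrow> 'v"
    and Y :: "'v \<Rightarrow> int \<Rightarrow> 'v \<Rightarrow> 'v"
    and vac :: 'v +
  fixes V :: "int \<Rightarrow> 'v set"
  assumes subspace_grade: "subspace (V n)"
    and direct_sum: "\<exists>!x :: int \<Rightarrow> 'v.
          (\<forall>n. x n \<in> V n) \<and> finite {n. x n \<noteq> 0} \<and> v = (\<Sum>n | x n \<noteq> 0. x n)"
    and grade_product: "a \<in> V n \<Longrightarrow> b \<in> V m \<Longrightarrow> Y a k b \<in> V (n + m - k - 1)"
    and vac_grade: "vac \<in> V 0"

locale conformal_vertex_algebra = graded_vertex_algebra scale Y vac V
  for scale :: "'k::field_char_0 \<Rightarrow> 'v::ab_group_add \<Rightarrow> 'v"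
    and Y :: "'v \<Rightarrow> int \<Rightarrow> 'v \<Rightarrow> 'v"
    and vac :: 'v
    and V :: "int \<Rightarrow> 'v set" +
  fixes \<omega> :: 'v
  assumes omega_grade: "\<omega> \<in> V 2"
    and virasoro: "\<exists>c. \<forall>n m v.
          Y \<omega> (n + 1) (Y \<omega> (m + 1) v) - Y \<omega> (m + 1) (Y \<omega> (n + 1) v)
          = scale (of_int (n - m)) (Y \<omega> (n + m + 1) v)
            + scale (1 / 12 * (if n + m = 0 then 1 else 0) * of_int (n ^ 3 - n) * c) v"
    and L0_grade: "v \<in> V n \<Longrightarrow> Y \<omega> 1 v = scale (of_int n) v"
    and L_minus1: "Y \<omega> 0 v = T v"

locale CFT_VOA = conformal_vertex_algebra scale Y vac V \<omega>
  for scale :: "'k::field_char_0 \<Rightarrow> 'v::ab_group_add \<Rightarrow> 'v"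
    and Y :: "'v \<Rightarrow> int \<Rightarrow> 'v \<Rightarrow> 'v"
    and vac :: 'v
    and V :: "int \<Rightarrow> 'v set"
    and \<omega> :: 'v +
  assumes grade_neg: "n < 0 \<Longrightarrow> V n = {0}"
    and grade_finite_dim: "\<exists>B. finite B \<and> span B = V n"
    and grade_zero: "V 0 = {scale k vac | k. True}"

locale strong_CFT_VOA = CFT_VOA scale Y vac V \<omega>
  for scale :: "'k::field_char_0 \<Rightarrow> 'v::ab_group_add \<Rightarrow> 'v"
    and Y :: "'v \<Rightarrow> int \<Rightarrow> 'v \<Rightarrow> 'v"
    and vac :: 'v
    and V :: "int \<Rightarrow> 'v set"
    and \<omega> :: 'v +
  assumes L1_grade_one: "v \<in> V 1 \<Longrightarrow> Y \<omega> 2 v = 0"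

definition (in vertex_algebra) CV_sCFT :: "'v set" where
  "CV_sCFT = {a. strong_CFT_VOA scale Y vac (\<lambda>n. {v. Y a 1 v = scale (of_int n) v}) a}"

end

theory Submission
  imports Defs
begin

text \<open>
  It suffices to take a simple VOA $V$ of strong CFT type with conformal vector $\omega$ and to map
  an arbitrary conformal vector $a$ of strong CFT type to $\omega$ by an automorphism. Gradings and
  components $a_n$ refer to $\omega$, and $L(n) = \omega(n+1)$.

  The difference $x = a - \omega$ satisfies $x(0) = 0$, because $a(0) = T = \omega(0)$, and hence
  each component of $x$ has the same property. A vector $u \in V_n$ with $u(0) = 0$ and $n \ge 2$
  lies in $TV_{n-1}$ (lemma \<open>zero_mode_vanishes_imp_in_range_T\<close>). So
  $a = a_0 + h + (\omega + Tv_1) + Tv_2 + \dots$ with $h \in V_1$, $h(0) = 0$ and $v_n \in V_n$.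
  Three steps remain.

  Because $h(0) = 0$, the operator $h(1)$ is a derivation; it lowers the degree, so its exponentials
  are automorphisms, and $\exp(-h(1))$ maps $a$ to a vector without component in degree 1 (lemma
  \<open>remove_degree_one\<close>).

  If $h = 0$, then also $a_0 = 0$ and $Tv_1 = 0$ (lemma \<open>lowest_component_is_omega\<close>). This is where
  simplicity enters: a nonzero $v \in V_1$ has a partner $b \in V_1$ with $v(1)b \ne 0$ (lemma
  \<open>nondegenerate_degree_one\<close>), and for $v = v_1$ this contradicts the vanishing of $a(2)$ on the
  1-eigenspace of $a(1)$.

  Now $a - \omega$ has only components of degree at least 3, so $a(1)$ is $L(0)$ plus an operator
  raising the degree. The $n$-eigenspace of $a(1)$ consists of vectors whose lowest component has
  degree $n$, and sending such a vector to its component of degree $n$ identifies $V$ with the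
  associated graded space of the filtration by degree, which is $V$ itself. This map is the desired
  automorphism (lemma \<open>exists_automorphism_lowest_component\<close>): products are compatible with lowest
  components, and $a$, which lies in the 2-eigenspace, has lowest component $\omega$.
\<close>

section \<open>Direct sum decompositions\<close>

text \<open>A vector space with a decomposition into a direct sum of subspaces indexed by the integers.\<close>

locale graded_space = vector_space scale
  for scale :: "'k::field \<Rightarrow> 'v::ab_group_add \<Rightarrow> 'v" +
  fixes V :: "int \<Rightarrow> 'v set"
  assumes subspace_component: "subspace (V n)"
    and unique_decomposition: "\<exists>!x :: int \<Rightarrow> 'v.
          (\<forall>n. x n \<in> V n) \<and> finite {n. x n \<noteq> 0} \<and> v = (\<Sum>n | x n \<noteq> 0. x n)"
begin

text \<open>The homogeneous component of degree \<open>n\<close> of a vector.\<close>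

definition proj :: "int \<Rightarrow> 'v \<Rightarrow> 'v" where
  "proj n v = (THE x. (\<forall>n. x n \<in> V n) \<and> finite {n. x n \<noteq> 0} \<and> v = (\<Sum>n | x n \<noteq> 0. x n)) n"

lemma proj_props:
  "(\<forall>n. proj n v \<in> V n) \<and> finite {n. proj n v \<noteq> 0} \<and> v = (\<Sum>n | proj n v \<noteq> 0. proj n v)"
  using theI'[OF unique_decomposition[of v]] unfolding proj_def .

lemma proj_in [simp, intro]: "proj n v \<in> V n"
  and finite_proj [simp, intro]: "finite {n. proj n v \<noteq> 0}"
  and proj_decomposition: "v = (\<Sum>n | proj n v \<noteq> 0. proj n v)"
  using proj_props[of v] by blast+

lemma proj_sum:
  assumes "finite S" "{n. proj n v \<noteq> 0} \<subseteq> S"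
  shows "(\<Sum>n\<in>S. proj n v) = v"
proof -
  have "(\<Sum>n\<in>S. proj n v) = (\<Sum>n | proj n v \<noteq> 0. proj n v)"
    using assms by (intro sum.mono_neutral_right) auto
  thus ?thesis using proj_decomposition[of v] by simp
qed

lemma proj_eqI:
  assumes x: "\<And>n. x n \<in> V n" and S: "finite S" "\<And>n. n \<notin> S \<Longrightarrow> x n = 0" and v: "v = sum x S"
  shows "proj n v = x n"
proof -
  have sub: "{n. x n \<noteq> 0} \<subseteq> S" using S(2) by blast
  have "finite {n. x n \<noteq> 0}" using sub S(1) finite_subset by blast
  moreover have "v = (\<Sum>n | x n \<noteq> 0. x n)"
    unfolding v using sub S(1) by (intro sum.mono_neutral_right) auto
  ultimately have "(THE x. (\<forall>n. x n \<in> V n) \<and> finite {n. x n \<noteq> 0} \<and> v = (\<Sum>n | x n \<noteq> 0. x n)) = x"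
    using x by (intro the1_equality[OF unique_decomposition]) blast
  thus ?thesis unfolding proj_def by simp
qed

lemma zero_in [simp]: "0 \<in> V n"
  using subspace_0[OF subspace_component] .

lemma proj_same [simp]: "v \<in> V n \<Longrightarrow> proj n v = v"
  and proj_other: "v \<in> V n \<Longrightarrow> m \<noteq> n \<Longrightarrow> proj m v = 0"
  using proj_eqI[of "\<lambda>m. if m = n then v else 0" "{n}" v] by auto

lemma proj_add: "proj n (u + v) = proj n u + proj n v"
proof (rule proj_eqI)
  show "finite ({n. proj n u \<noteq> 0} \<union> {n. proj n v \<noteq> 0})" by simp
  show "u + v = (\<Sum>n\<in>{n. proj n u \<noteq> 0} \<union> {n. proj n v \<noteq> 0}. proj n u + proj n v)"
    by (simp add: sum.distrib proj_sum)
qed (auto intro: subspace_add subspace_component)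

lemma proj_scale: "proj n (scale c v) = scale c (proj n v)"
proof (rule proj_eqI)
  show "finite {n. proj n v \<noteq> 0}" by simp
  show "scale c v = (\<Sum>n | proj n v \<noteq> 0. scale c (proj n v))"
    by (simp add: scale_sum_right[symmetric] proj_sum)
qed (auto intro: subspace_scale subspace_component)

lemma linear_proj: "Vector_Spaces.linear scale scale (proj n)"
  by (simp add: Vector_Spaces.linear_iff vector_space_axioms proj_add proj_scale)

lemma proj_zero [simp]: "proj n 0 = 0"
  using proj_same[OF zero_in] .

lemma proj_diff: "proj n (u - v) = proj n u - proj n v"
  using module_hom.diff[OF module_hom_linearI[OF linear_proj]] .

lemma proj_sum_distrib: "proj n (sum g S) = (\<Sum>i\<in>S. proj n (g i))"
  using module_hom.sum[OF module_hom_linearI[OF linear_proj]] .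

lemma eq_zeroI_proj: "(\<And>n. proj n v = 0) \<Longrightarrow> v = 0"
  using proj_sum[of "{}" v] by simp

lemma linear_eqI:
  assumes f: "Vector_Spaces.linear scale scale f" and g: "Vector_Spaces.linear scale scale g"
    and eq: "\<And>n v. v \<in> V n \<Longrightarrow> f v = g v"
  shows "f v = g v"
proof -
  let ?S = "{n. proj n v \<noteq> 0}"
  have "f (\<Sum>n\<in>?S. proj n v) = g (\<Sum>n\<in>?S. proj n v)"
    unfolding module_hom.sum[OF module_hom_linearI[OF f]] module_hom.sum[OF module_hom_linearI[OF g]]
    by (simp add: eq[OF proj_in])
  thus ?thesis by (simp add: proj_sum)
qed

lemma least_degree:
  assumes "v \<noteq> 0"
  obtains m where "proj m v \<noteq> 0" "\<And>k. k < m \<Longrightarrow> proj k v = 0"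
proof -
  have ne: "{n. proj n v \<noteq> 0} \<noteq> {}" using assms eq_zeroI_proj by blast
  show thesis
  proof (rule that)
    show "proj (Min {n. proj n v \<noteq> 0}) v \<noteq> 0" using Min_in[OF finite_proj ne] by simp
    show "proj k v = 0" if "k < Min {n. proj n v \<noteq> 0}" for k
      using that Min_le[OF finite_proj, of k v] by fastforce
  qed
qed

end

lemma (in graded_space) graded_space_image:
  assumes f: "Vector_Spaces.linear scale scale f" and bij: "bij f"
  shows "graded_space scale (\<lambda>n. f ` V n)"
proof
  interpret f: Vector_Spaces.linear scale scale f by (rule f)
  fix n v
  show "subspace (f ` V n)" by (rule f.subspace_image[OF subspace_component])
  obtain u where u: "v = f u" using bij by (metis bij_pointE)
  have f0: "f w = 0 \<longleftrightarrow> w = 0" for w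
    using bij f.zero by (metis bij_is_inj injD)
  show "\<exists>!x. (\<forall>n. x n \<in> f ` V n) \<and> finite {n. x n \<noteq> 0} \<and> v = (\<Sum>n | x n \<noteq> 0. x n)"
  proof (rule ex1I)
    show "(\<forall>n. f (proj n u) \<in> f ` V n) \<and> finite {n. f (proj n u) \<noteq> 0}
      \<and> v = (\<Sum>n | f (proj n u) \<noteq> 0. f (proj n u))"
      unfolding f0 u f.sum[symmetric] by (simp add: proj_sum)
    fix x assume x: "(\<forall>n. x n \<in> f ` V n) \<and> finite {n. x n \<noteq> 0} \<and> v = (\<Sum>n | x n \<noteq> 0. x n)"
    hence "\<forall>n. \<exists>y. y \<in> V n \<and> x n = f y" by blast
    then obtain y where y: "\<And>n. y n \<in> V n" "\<And>n. x n = f (y n)" by metis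
    have x0: "x n \<noteq> 0 \<longleftrightarrow> y n \<noteq> 0" for n by (simp add: y(2) f0)
    have "f u = f (\<Sum>n | y n \<noteq> 0. y n)"
      using x unfolding u x0 f.sum by (simp add: y(2))
    hence "u = (\<Sum>n | y n \<noteq> 0. y n)" using bij by (metis bij_is_inj injD)
    hence "proj n u = y n" for n
      using x y(1) unfolding x0 by (intro proj_eqI[of y "{n. y n \<noteq> 0}"]) auto
    thus "x = (\<lambda>n. f (proj n u))" using y(2) by auto
  qed
qed

sublocale graded_vertex_algebra \<subseteq> graded_space scale V
  by unfold_locales (rule subspace_grade, rule direct_sum)

section \<open>Consequences of the Borcherds identity\<close>

context vertex_algebra
begin

lemma Y_add_left: "Y (a + b) n c = Y a n c + Y b n c"
  and Y_scale_left: "Y (scale k a) n c = scale k (Y a n c)"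
  and Y_scale_right: "Y a n (scale k b) = scale k (Y a n b)"
  using linear_left linear_right by (simp_all add: Vector_Spaces.linear_iff)

lemma Y_zero_left [simp]: "Y 0 n c = 0" and Y_zero_right [simp]: "Y a n 0 = 0"
  using Y_scale_left[of 0] Y_scale_right[of _ _ 0] by simp_all

lemma Y_diff_left: "Y (a - b) n c = Y a n c - Y b n c"
  by (rule module_hom.diff[OF module_hom_linearI[OF linear_left]])

lemma Y_diff_right: "Y a n (b - c) = Y a n b - Y a n c"
  by (rule module_hom.diff[OF module_hom_linearI[OF linear_right]])

lemma Y_sum_left: "Y (sum g S) n c = (\<Sum>i\<in>S. Y (g i) n c)"
  by (rule module_hom.sum[OF module_hom_linearI[OF linear_left]])

lemma Y_sum_right: "Y a n (sum g S) = (\<Sum>i\<in>S. Y a n (g i))"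
  by (rule module_hom.sum[OF module_hom_linearI[OF linear_right]])

lemma Y_vac_nonneg [simp]: "n \<ge> 0 \<Longrightarrow> Y vac n a = 0"
  by (simp add: vacuum)

lemma T_vac: "T vac = 0"
  by (simp add: T_def vacuum)

lemma linear_T: "Vector_Spaces.linear scale scale T"
  unfolding T_def by (rule linear_left)

text \<open>The commutator formula is the Borcherds identity with $r = 0$.\<close>

lemma commutator:
  "Y a (int N) (Y b q c) - Y b q (Y a (int N) c)
    = (\<Sum>i\<le>N. scale (of_nat (N choose i)) (Y (Y a (int i) b) (int N + q - int i) c))"
proof -
  have 1: "of_int (int N) gchoose i = (of_nat (N choose i) :: 'k)" for i
    by (simp add: binomial_gbinomial)
  have "Sum_any (\<lambda>i::nat. scale (of_int (int N) gchoose i) (Y (Y a (0 + int i) b) (int N + q - int i) c))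
    = (\<Sum>i\<le>N. scale (of_int (int N) gchoose i) (Y (Y a (0 + int i) b) (int N + q - int i) c))"
    unfolding 1 by (rule Sum_any.expand_superset) (auto simp: binomial_eq_0 leI)
  moreover have "Sum_any (\<lambda>i::nat. scale ((-1) ^ i * (of_int 0 gchoose i))
           (Y a (int N + 0 - int i) (Y b (q + int i) c)
            - scale ((-1) powi 0) (Y b (q + 0 - int i) (Y a (int N + int i) c))))
     = Y a (int N) (Y b q c) - Y b q (Y a (int N) c)"
    by (subst Sum_any.expand_superset[of "{0}"]) (auto simp: gbinomial_0_left)
  ultimately show ?thesis
    using borcherds[of "int N" a 0 b q c] unfolding 1 by simp
qed

lemma commutator_0: "Y a 0 (Y b q c) - Y b q (Y a 0 c) = Y (Y a 0 b) q c"
  using commutator[of a 0 b q c] by simp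

lemma commutator_1: "Y a 1 (Y b q c) - Y b q (Y a 1 c) = Y (Y a 0 b) (q + 1) c + Y (Y a 1 b) q c"
  using commutator[of a 1 b q c] by (simp add: add.commute)

lemma commutator_2:
  "Y a 2 (Y b q c) - Y b q (Y a 2 c)
    = Y (Y a 0 b) (q + 2) c + scale 2 (Y (Y a 1 b) (q + 1) c) + Y (Y a 2 b) q c"
proof -
  have "{..2::nat} = {0, 1, 2}" by auto
  thus ?thesis using commutator[of a 2 b q c]
    by (simp add: numeral_2_eq_2[symmetric] algebra_simps)
qed

text \<open>The Borcherds identity with $p = 0$, $r = -2$ and $b = \mathbf{1}$; on either side only one
  summand can be nonzero.\<close>

lemma Y_T: "Y (T a) q c = scale (- of_int q) (Y a (q - 1) c)"
proof -
  have coeff: "(-1) ^ i * (of_int (-2) gchoose i) = (of_nat (Suc i) :: 'k)" for i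
  proof -
    have "(of_int (-2) gchoose i :: 'k) = (-1) ^ i * (of_nat (Suc i) gchoose i)"
      using gbinomial_minus[of "2::'k" i] by (simp add: add.commute)
    moreover have "(of_nat (Suc i) gchoose i :: 'k) = of_nat (Suc i)"
      by (metis binomial_Suc_n binomial_gbinomial)
    ultimately show ?thesis by (simp add: mult.assoc[symmetric] power_mult_distrib[symmetric])
  qed
  have lhs: "Sum_any (\<lambda>i::nat. scale (of_int 0 gchoose i) (Y (Y a (-2 + int i) vac) (0 + q - int i) c))
     = Y (T a) q c"
    by (subst Sum_any.expand_superset[of "{0}"]) (auto simp: gbinomial_0_left T_def)
  define g where "g i = scale (of_nat (Suc i))
           (Y a (0 + -2 - int i) (Y vac (q + int i) c)
            - scale ((-1) powi -2) (Y vac (q + -2 - int i) (Y a (0 + int i) c)))" for i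
  have main: "Y (T a) q c = Sum_any g"
    using borcherds[of 0 a "-2" vac q c] unfolding lhs coeff g_def .
  consider "q < 0" | "q = 0" | "q > 0" by linarith
  thus ?thesis
  proof cases
    case 1
    define i where "i = nat (- 1 - q)"
    have q: "q = - 1 - int i" using 1 unfolding i_def by simp
    have "Sum_any g = sum g {i}"
      by (rule Sum_any.expand_superset) (auto simp: g_def vacuum q)
    moreover have "g i = scale (- of_int q) (Y a (q - 1) c)"
    proof -
      have "0 + - 2 - int i = q - 1" using q by simp
      thus ?thesis unfolding g_def by (simp add: vacuum q)
    qed
    ultimately show ?thesis unfolding main by simp
  next
    case 2
    have "g i = 0" for i unfolding g_def 2 by (simp add: vacuum)
    thus ?thesis unfolding main by (simp add: 2)
  next
    case 3
    define i where "i = nat (q - 1)"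
    have q: "q = 1 + int i" using 3 unfolding i_def by simp
    have "Sum_any g = sum g {i}"
      by (rule Sum_any.expand_superset) (auto simp: g_def vacuum q)
    thus ?thesis unfolding main by (simp add: g_def vacuum q scale_left_distrib scale_left_diff_distrib)
  qed
qed

text \<open>
  Skew symmetry is the Borcherds identity with $p = -1$, $q = 0$ and $c = \mathbf{1}$. Here
  $v(-1-i)\mathbf{1}$ stands for $T^i v / i!$.
\<close>

lemma skew_symmetry:
  "scale ((-1) powi r) (Y b r a)
    = - Sum_any (\<lambda>i::nat. scale ((-1) ^ i) (Y (Y a (r + int i) b) (- 1 - int i) vac))"
proof -
  have coeff: "of_int (-1) gchoose i = ((-1) ^ i :: 'k)" for i
    by (simp add: gbinomial_minus binomial_gbinomial[symmetric] gbinomial_minus[of 1, simplified])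
  have "Sum_any (\<lambda>i::nat. scale ((-1) ^ i * (of_int r gchoose i))
           (Y a (- 1 + r - int i) (Y b (0 + int i) vac)
            - scale ((-1) powi r) (Y b (0 + r - int i) (Y a (- 1 + int i) vac))))
     = - scale ((-1) powi r) (Y b r a)"
  proof (subst Sum_any.expand_superset[of "{0}"])
    have "Y a (- 1 + int i) vac = 0" if "i \<noteq> 0" for i
      using that by (intro creation_nonneg) simp
    thus "{i. scale ((-1) ^ i * (of_int r gchoose i))
           (Y a (- 1 + r - int i) (Y b (0 + int i) vac)
            - scale ((-1) powi r) (Y b (0 + r - int i) (Y a (- 1 + int i) vac))) \<noteq> 0} \<subseteq> {0}"
      by (auto simp: creation_nonneg intro: ccontr)
  qed (simp_all add: creation creation_nonneg)
  thus ?thesis using borcherds[of "-1" a r b 0 vac] unfolding coeff by simp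
qed

lemma Sum_any_in_subspace:
  assumes "subspace W" "\<And>i. g i \<in> W"
  shows "Sum_any g \<in> W"
  unfolding Sum_any.expand_set using assms by (rule subspace_sum)

text \<open>
  The vectors $c(k)h$ span a subspace stable under all operators $a(m)$. Choose $P$ with
  $a(k)h = 0$ for $k \ge P$. The Borcherds identity with $p = P$ and $r = m - P$ then expresses
  $a(m)b(n)h$ by vectors $c(k)h$ and by $a(m-i)b(n+i)h$ with $i > 0$, so that descending induction
  on $n$ applies.
\<close>

lemma span_products_closed:
  "Y a m (Y b n h) \<in> span {Y c k h | c k. True}" (is "_ \<in> ?W")
proof -
  obtain P where P: "\<And>k. k \<ge> P \<Longrightarrow> Y a k h = 0" using truncation by blast
  obtain Q where Q: "\<And>k. k \<ge> Q \<Longrightarrow> Y b k h = 0" using truncation by blast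
  have "\<forall>m. Y a m (Y b n h) \<in> ?W"
  proof (induction "nat (Q - n)" arbitrary: n rule: less_induct)
    case less
    show ?case
    proof (cases "n \<ge> Q")
      case True
      thus ?thesis by (simp add: Q span_zero)
    next
      case False
      show ?thesis
      proof
        fix m
        define r where "r = m - P"
        define g where "g i = scale ((-1) ^ i * (of_int r gchoose i))
           (Y a (P + r - int i) (Y b (n + int i) h)
            - scale ((-1) powi r) (Y b (n + r - int i) (Y a (P + int i) h)))" for i
        have g: "g i = scale ((-1) ^ i * (of_int r gchoose i)) (Y a (m - int i) (Y b (n + int i) h))" for i
          unfolding g_def r_def by (simp add: P)
        have "Sum_any (\<lambda>i::nat. scale (of_int P gchoose i) (Y (Y a (r + int i) b) (P + n - int i) h)) \<in> ?W"
          by (intro Sum_any_in_subspace subspace_span span_scale span_base) blast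
        hence S: "Sum_any g \<in> ?W" using borcherds[of P a r b n h] unfolding g_def by simp
        have gi: "g i \<in> ?W" if "i > 0" for i
          unfolding g using less.hyps[of "n + int i"] that False by (intro span_scale) auto
        have "{i. g i \<noteq> 0} \<subseteq> {..nat (Q - n)}"
          using Q unfolding g by (auto intro: ccontr)
        hence "Sum_any g = sum g {..nat (Q - n)}" by (intro Sum_any.expand_superset) auto
        also have "\<dots> = g 0 + sum g ({..nat (Q - n)} - {0})" by (subst sum.remove[of _ 0]) auto
        finally have "g 0 = Sum_any g - sum g ({..nat (Q - n)} - {0})" by simp
        also have "\<dots> \<in> ?W" by (intro span_diff S span_sum gi) auto
        finally show "Y a m (Y b n h) \<in> ?W" by (simp add: g)
      qed
    qed
  qed
  thus ?thesis by blast
qed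

end

section \<open>Homogeneous components of products\<close>

context vector_space
begin

lemma linear_comp:
  assumes "Vector_Spaces.linear scale scale f" "Vector_Spaces.linear scale scale g"
  shows "Vector_Spaces.linear scale scale (\<lambda>x. f (g x))"
  using Vector_Spaces.linear_compose[OF assms(2,1)] unfolding o_def .

lemma linear_const_zero: "Vector_Spaces.linear scale scale (\<lambda>x. 0)"
  by (simp add: Vector_Spaces.linear_iff vector_space_axioms)

lemma subspace_scale_cancel:
  assumes "subspace W" "scale c x \<in> W" "c \<noteq> 0" shows "x \<in> W"
  using subspace_scale[OF assms(1,2), of "inverse c"] assms(3) by simp

end

context graded_vertex_algebra
begin

lemma grade_product_eq: "a \<in> V n \<Longrightarrow> b \<in> V m \<Longrightarrow> n + m - k - 1 = l \<Longrightarrow> Y a k b \<in> V l"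
  using grade_product by blast

lemma proj_Y_left:
  assumes "u \<in> V i"
  shows "proj k (Y u n v) = Y u n (proj (k - i + n + 1) v)"
proof (rule linear_eqI[where f = "\<lambda>v. proj k (Y u n v)"])
  show "Vector_Spaces.linear scale scale (\<lambda>v. proj k (Y u n v))"
    by (rule linear_comp[OF linear_proj linear_right])
  show "Vector_Spaces.linear scale scale (\<lambda>v. Y u n (proj (k - i + n + 1) v))"
    by (rule linear_comp[OF linear_right linear_proj])
  fix m v assume v: "v \<in> V m"
  have Yin: "Y u n v \<in> V (i + m - n - 1)" using assms v by (rule grade_product)
  show "proj k (Y u n v) = Y u n (proj (k - i + n + 1) v)"
  proof (cases "k = i + m - n - 1")
    case True
    hence "k - i + n + 1 = m" by simp
    thus ?thesis using proj_same[OF Yin] proj_same[OF v] True by metis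
  next
    case False
    hence "k - i + n + 1 \<noteq> m" by simp
    thus ?thesis using proj_other[OF Yin False] proj_other[OF v] by simp
  qed
qed

lemma proj_Y_right:
  assumes "v \<in> V j"
  shows "proj k (Y u n v) = Y (proj (k - j + n + 1) u) n v"
proof (rule linear_eqI[where f = "\<lambda>u. proj k (Y u n v)"])
  show "Vector_Spaces.linear scale scale (\<lambda>u. proj k (Y u n v))"
    by (rule linear_comp[OF linear_proj linear_left])
  show "Vector_Spaces.linear scale scale (\<lambda>u. Y (proj (k - j + n + 1) u) n v)"
    by (rule linear_comp[OF linear_left linear_proj])
  fix m u assume u: "u \<in> V m"
  have Yin: "Y u n v \<in> V (m + j - n - 1)" using u assms by (rule grade_product)
  show "proj k (Y u n v) = Y (proj (k - j + n + 1) u) n v"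
  proof (cases "k = m + j - n - 1")
    case True
    hence "k - j + n + 1 = m" by simp
    thus ?thesis using proj_same[OF Yin] proj_same[OF u] True by metis
  next
    case False
    hence "k - j + n + 1 \<noteq> m" by simp
    thus ?thesis using proj_other[OF Yin False] proj_other[OF u] by simp
  qed
qed

lemma Y_proj_eq_zero:
  assumes "\<And>v. Y u n v = 0"
  shows "Y (proj i u) n v = 0"
proof (rule linear_eqI[where f = "\<lambda>v. Y (proj i u) n v"])
  fix m v assume v: "v \<in> V m"
  show "Y (proj i u) n v = 0"
    using proj_Y_right[OF v, of "i + m - n - 1" u n] by (simp add: assms)
qed (rule linear_right linear_const_zero)+

lemma proj_Y:
  "proj k (Y a n y) = (\<Sum>i | proj i a \<noteq> 0. Y (proj i a) n (proj (k - i + n + 1) y))"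
proof -
  have "proj k (Y a n y) = proj k (Y (\<Sum>i | proj i a \<noteq> 0. proj i a) n y)"
    by (simp add: proj_sum)
  thus ?thesis by (simp add: Y_sum_left proj_sum_distrib proj_Y_left[OF proj_in])
qed

text \<open>If the degrees are bounded below by \<open>I\<close> and \<open>J\<close>, then in the least possible degree of the
  product only the components of degrees \<open>I\<close> and \<open>J\<close> contribute.\<close>

lemma proj_Y_lowest:
  assumes a: "\<And>i. i < I \<Longrightarrow> proj i a = 0" and y: "\<And>j. j < J \<Longrightarrow> proj j y = 0"
  shows "proj (I + J - n - 1) (Y a n y) = Y (proj I a) n (proj J y)"
    and "k < I + J - n - 1 \<Longrightarrow> proj k (Y a n y) = 0"
proof -
  have zero: "Y (proj i a) n (proj (k - i + n + 1) y) = 0" if "k \<le> I + J - n - 1" "i \<noteq> I \<or> k \<noteq> I + J - n - 1" for i k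
  proof (cases "i < I")
    case False
    hence "k - i + n + 1 < J" using that by auto
    thus ?thesis by (simp add: y)
  qed (simp add: a)
  have "proj (I + J - n - 1) (Y a n y)
    = (\<Sum>i | proj i a \<noteq> 0. if i = I then Y (proj I a) n (proj J y) else 0)"
    unfolding proj_Y by (intro sum.cong refl) (use zero[of "I + J - n - 1"] in \<open>auto simp: algebra_simps\<close>)
  thus "proj (I + J - n - 1) (Y a n y) = Y (proj I a) n (proj J y)"
    by auto
  show "proj k (Y a n y) = 0" if "k < I + J - n - 1"
    unfolding proj_Y using zero[of k] that by (intro sum.neutral) auto
qed

end

section \<open>Translation operator and skew symmetry\<close>

context conformal_vertex_algebra
begin

lemma T_product: "T (Y a n b) = Y (T a) n b + Y a n (T b)"
  using commutator_0[of \<omega> a n b] by (simp add: L_minus1 algebra_simps)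

lemma proj_T: "proj n (T z) = T (proj (n - 1) z)"
  using proj_Y_left[OF omega_grade, of n 0 z] by (simp add: L_minus1 algebra_simps)

lemma subspace_range_T: "subspace (range T)"
  using module_hom.subspace_image[OF module_hom_linearI[OF linear_T] subspace_UNIV] .

lemma T_Y_vac: "T (Y v (- int i) vac) = scale (of_nat i) (Y v (- 1 - int i) vac)"
proof -
  have "- int i - 1 = - 1 - int i" by simp
  hence "Y (T v) (- int i) vac = scale (of_nat i) (Y v (- 1 - int i) vac)"
    using Y_T[of v "- int i" vac] by (metis minus_minus of_int_minus of_int_of_nat_eq)
  thus ?thesis unfolding T_product by (simp add: T_vac)
qed

lemma descendant_in_range_T:
  assumes "i > 0" shows "Y v (- 1 - int i) vac \<in> range T"
proof (rule subspace_scale_cancel[OF subspace_range_T])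
  show "scale (of_nat i) (Y v (- 1 - int i) vac) \<in> range T" unfolding T_Y_vac[symmetric] by simp
qed (use assms in simp)

lemma skew_symmetry_mod_T: "scale ((-1) powi r) (Y b r a) + Y a r b \<in> range T"
proof -
  define g where "g i = scale ((-1) ^ i) (Y (Y a (r + int i) b) (- 1 - int i) vac)" for i
  obtain N where N: "\<And>n. n \<ge> N \<Longrightarrow> Y a n b = 0" using truncation by blast
  have "{i. g i \<noteq> 0} \<subseteq> {..nat (N - r)}" using N unfolding g_def by (auto intro: ccontr)
  hence "Sum_any g = sum g {..nat (N - r)}" by (intro Sum_any.expand_superset) auto
  also have "\<dots> = g 0 + sum g ({..nat (N - r)} - {0})" by (subst sum.remove[of _ 0]) auto
  finally have "scale ((-1) powi r) (Y b r a) + Y a r b = - sum g ({..nat (N - r)} - {0})"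
    using skew_symmetry[of r b a] unfolding g_def by (simp add: creation)
  also have "\<dots> \<in> range T"
    by (intro subspace_neg[OF subspace_range_T] subspace_sum[OF subspace_range_T])
      (auto simp: g_def intro!: subspace_scale[OF subspace_range_T] descendant_in_range_T)
  finally show ?thesis .
qed

text \<open>
  From $0 = [L(1),u(0)] = (2n-2)u(1) + (L(1)u)(0)$ one finds that $u(1)$ is a multiple of $w(0)$
  with $w = L(1)u$. Modulo the image of $T$, skew symmetry gives
  $nu = \omega(1)u \equiv u(1)\omega$ and $w(0)\omega \equiv -\omega(0)w = -Tw \equiv 0$.
\<close>

lemma zero_mode_vanishes_imp_in_range_T:
  assumes u: "u \<in> V n" and n: "n \<noteq> 0" "n \<noteq> 1" and u0: "\<And>v. Y u 0 v = 0"
  obtains w where "w \<in> V (n - 1)" "u = T w"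
proof -
  note R = subspace_range_T
  have Tu: "Y \<omega> 0 u = T u" and Lu: "Y \<omega> 1 u = scale (of_int n) u"
    using L_minus1 L0_grade[OF u] by auto
  have "0 = Y (T u) 2 \<omega> + scale 2 (Y (scale (of_int n) u) 1 \<omega>) + Y (Y \<omega> 2 u) 0 \<omega>"
    using commutator_2[of \<omega> u 0 \<omega>] by (simp add: u0 Tu Lu)
  hence "scale (2 - 2 * of_int n) (Y u 1 \<omega>) = Y (Y \<omega> 2 u) 0 \<omega>"
    by (simp add: Y_T Y_scale_left scale_left_diff_distrib algebra_simps)
  also have "Y (Y \<omega> 2 u) 0 \<omega> \<in> range T"
    using subspace_diff[OF R skew_symmetry_mod_T[of 0 "Y \<omega> 2 u" \<omega>], of "T (Y \<omega> 2 u)"]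
    by (simp add: L_minus1)
  finally have "Y u 1 \<omega> \<in> range T"
  proof (rule subspace_scale_cancel[OF R])
    have "2 - 2 * of_int n = (of_int (2 - 2 * n) :: 'k)" by simp
    thus "2 - 2 * of_int n \<noteq> (0 :: 'k)" using n by (simp only: of_int_eq_0_iff)
  qed
  from subspace_diff[OF R skew_symmetry_mod_T[of 1 \<omega> u] this]
  have "- Y \<omega> 1 u \<in> range T" by simp
  from subspace_neg[OF R this] have "Y \<omega> 1 u \<in> range T" by simp
  hence "scale (of_int n) u \<in> range T" by (simp add: Lu)
  hence "u \<in> range T" by (rule subspace_scale_cancel[OF R]) (simp add: n)
  then obtain z where z: "u = T z" by blast
  have "u = T (proj (n - 1) z)" using proj_T[of n z] u unfolding z[symmetric] by simp
  thus thesis by (rule that[OF proj_in])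
qed

text \<open>By skew symmetry the span of the vectors $c(k)h$ is a two-sided ideal.\<close>

lemma is_ideal_span_products: "is_ideal (span {Y c k h | c k. True})" (is "is_ideal ?I")
proof -
  have left: "Y a m v \<in> ?I" if "v \<in> ?I" for a m v
    using that
  proof (induction rule: span_induct)
    case base
    show ?case
      using module_hom.subspace_vimage[OF module_hom_linearI[OF linear_right[of a m]] subspace_span]
      by (simp add: vimage_def)
  next
    case (step x)
    thus ?case using span_products_closed by auto
  qed
  have desc: "Y v (- 1 - int i) vac \<in> ?I" if "v \<in> ?I" for v i
  proof (induction i)
    case 0
    thus ?case using that by (simp add: creation)
  next
    case (Suc i)
    have "Y \<omega> 0 (Y v (- 1 - int i) vac) \<in> ?I" by (rule left[OF Suc])
    moreover have "- 1 - int i = - int (Suc i)" by simp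
    ultimately have "scale (of_nat (Suc i)) (Y v (- 1 - int (Suc i)) vac) \<in> ?I"
      by (simp only: T_Y_vac L_minus1)
    thus ?case by (rule subspace_scale_cancel[OF subspace_span]) (simp del: of_nat_Suc)
  qed
  have "Y v m a \<in> ?I" if "v \<in> ?I" for a m v
  proof (rule subspace_scale_cancel[OF subspace_span])
    show "scale ((-1) powi m) (Y v m a) \<in> ?I"
      unfolding skew_symmetry[of m v a]
      by (intro span_neg Sum_any_in_subspace[OF subspace_span] span_scale desc left that)
  qed simp
  thus ?thesis unfolding is_ideal_def using left subspace_span by blast
qed

end

section \<open>Nondegeneracy in degree one\<close>

context strong_CFT_VOA
begin

lemma T_grade_zero: "v \<in> V 0 \<Longrightarrow> T v = 0"
  using grade_zero T_vac module_hom.scale[OF module_hom_linearI[OF linear_T]] by auto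

lemma Y_nonneg_grade_zero:
  assumes "c \<in> V 0" "n \<ge> 0" shows "Y a n c = 0" "Y c n a = 0"
  using assms grade_zero by (auto simp: Y_scale_right Y_scale_left creation_nonneg)

lemma grade_neg_eq_zero: "v \<in> V n \<Longrightarrow> n < 0 \<Longrightarrow> v = 0"
  using grade_neg by blast

lemma proj_neg: "n < 0 \<Longrightarrow> proj n v = 0"
  using grade_neg_eq_zero[OF proj_in] .

text \<open>The identity $[L(1),h(n)] = -n\,h(n+1)$ and $L(1)V_1 = 0$ reduce $h(d)b$ to
  $h(1)L(1)^{d-1}b$.\<close>

lemma pairing_vanishes:
  assumes h: "h \<in> V 1" and h1: "\<And>b. b \<in> V 1 \<Longrightarrow> Y h 1 b = 0" and b: "b \<in> V (int d)"
  shows "Y h (int d) b = 0"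
  using b
proof (induction d arbitrary: b)
  case 0
  thus ?case using Y_nonneg_grade_zero by simp
next
  case (Suc d)
  show ?case
  proof (cases "d = 0")
    case True
    thus ?thesis using h1 Suc.prems by simp
  next
    case False
    have "Y h (int d) b \<in> V 1" by (rule grade_product_eq[OF h Suc.prems]) simp
    moreover have "Y \<omega> 2 b \<in> V (int d)" by (rule grade_product_eq[OF omega_grade Suc.prems]) simp
    moreover have "Y \<omega> 0 h = T h" "Y \<omega> 1 h = h" "Y \<omega> 2 h = 0"
      using L_minus1 L0_grade[OF h] L1_grade_one[OF h] by auto
    ultimately have "0 = Y (T h) (int d + 2) b + scale 2 (Y h (int d + 1) b)"
      using commutator_2[of \<omega> h "int d" b] Suc.IH L1_grade_one by simp
    hence "scale (of_nat d) (Y h (int (Suc d)) b) = 0"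
      by (simp add: Y_T algebra_simps scale_left_diff_distrib scale_left_distrib)
    thus ?thesis using False by simp
  qed
qed

text \<open>
  In a simple vertex algebra the ideal generated by $h$ contains $\mathbf{1}$, so some $b(n)h$ has
  a nonzero component in $V_0$. If $h(1)$ vanished on $V_1$, then by the preceding lemma and skew
  symmetry no such component could occur.
\<close>

lemma nondegenerate_degree_one:
  assumes simple: "is_simple" and h: "h \<in> V 1" and "h \<noteq> 0"
  obtains b where "b \<in> V 1" "Y h 1 b \<noteq> 0"
proof (rule ccontr)
  assume "\<not> thesis"
  hence h1: "\<And>b. b \<in> V 1 \<Longrightarrow> Y h 1 b = 0" using that by blast
  have zero: "proj 0 (Y b n h) = 0" for b n
  proof (rule linear_eqI[where f = "\<lambda>b. proj 0 (Y b n h)"])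
    show "Vector_Spaces.linear scale scale (\<lambda>b. proj 0 (Y b n h))"
      by (rule linear_comp[OF linear_proj linear_left])
    fix j b assume b: "b \<in> V j"
    have Yin: "Y b n h \<in> V (j - n)" by (rule grade_product_eq[OF b h]) simp
    consider "j \<noteq> n" | "j = n" "j < 0" | d where "j = n" "j = int d"
      by (metis int_nat_eq linorder_not_less)
    thus "proj 0 (Y b n h) = 0"
    proof cases
      case 1
      thus ?thesis using proj_other[OF Yin] by simp
    next
      case 2
      thus ?thesis using grade_neg_eq_zero[OF b] by simp
    next
      case 3
      hence "scale ((-1) powi n) (Y b n h) \<in> range T"
        using skew_symmetry_mod_T[of n b h] pairing_vanishes[OF h h1, of b d] b by simp
      hence "Y b n h \<in> range T" by (rule subspace_scale_cancel[OF subspace_range_T]) simp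
      thus ?thesis using proj_T proj_neg module_hom.zero[OF module_hom_linearI[OF linear_T]] by auto
    qed
  qed (rule linear_const_zero)
  let ?I = "span {Y c k h | c k. True}"
  have "h = Y vac (-1) h" by (simp add: vacuum)
  hence "h \<in> ?I" by (intro span_base) blast
  hence "?I = UNIV" using simple is_ideal_span_products[of h] \<open>h \<noteq> 0\<close> unfolding is_simple_def by blast
  moreover have "?I \<subseteq> {v. proj 0 v = 0}"
    using zero module_hom.subspace_kernel[OF module_hom_linearI[OF linear_proj]]
    by (intro span_minimal) auto
  ultimately have "proj 0 vac = 0" by blast
  hence "vac = 0" using vac_grade by simp
  hence "h = 0" using creation[of h] by simp
  thus False using \<open>h \<noteq> 0\<close> by simp
qed

end

section \<open>Exponentials of locally nilpotent derivations\<close>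

lemma sum_triangle_eq_sum_square:
  fixes g :: "nat \<Rightarrow> nat \<Rightarrow> 'a::comm_monoid_add"
  assumes "\<And>i j. i \<ge> N \<Longrightarrow> g i j = 0" "\<And>i j. j \<ge> M \<Longrightarrow> g i j = 0"
  shows "(\<Sum>k<N + M. \<Sum>i\<le>k. g i (k - i)) = (\<Sum>i<N. \<Sum>j<M. g i j)"
proof -
  have "finite {(i, j). i + j < N + M}"
    by (rule finite_subset[of _ "{..N + M} \<times> {..N + M}"]) auto
  hence "(\<Sum>(i, j)\<in>{(i, j). i + j < N + M}. g i j) = (\<Sum>(i, j)\<in>{..<N} \<times> {..<M}. g i j)"
    using assms by (intro sum.mono_neutral_right) (auto, metis not_le, metis not_le)
  thus ?thesis by (simp add: sum.triangle_reindex sum.cartesian_product)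
qed

context vertex_algebra
begin

text \<open>Derivations of the vertex algebra, that is, of all the products \<open>a(n)b\<close> at once.\<close>

definition is_derivation :: "('v \<Rightarrow> 'v) \<Rightarrow> bool" where
  "is_derivation D \<longleftrightarrow> Vector_Spaces.linear scale scale D \<and>
     (\<forall>a n b. D (Y a n b) = Y (D a) n b + Y a n (D b))"

text \<open>The exponential $\exp(tD)$; its sum is finite on each vector when \<open>D\<close> is locally
  nilpotent.\<close>

definition exp_op :: "'k \<Rightarrow> ('v \<Rightarrow> 'v) \<Rightarrow> 'v \<Rightarrow> 'v" where
  "exp_op t D v = (\<Sum>i | (D ^^ i) v \<noteq> 0. scale (t ^ i / fact i) ((D ^^ i) v))"

lemma linear_funpow:
  "Vector_Spaces.linear scale scale D \<Longrightarrow> Vector_Spaces.linear scale scale (D ^^ i)"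
proof (induction i)
  case 0
  thus ?case by (simp add: Vector_Spaces.linear_iff vector_space_axioms)
next
  case (Suc i)
  thus ?case using linear_comp[OF Suc.prems Suc.IH[OF Suc.prems]] by (simp add: o_def)
qed

lemma leibniz:
  assumes "is_derivation D"
  shows "(D ^^ k) (Y a n b)
    = (\<Sum>i\<le>k. scale (of_nat (k choose i)) (Y ((D ^^ i) a) n ((D ^^ (k - i)) b)))"
proof (induction k)
  case 0
  show ?case by simp
next
  case (Suc k)
  interpret D: Vector_Spaces.linear scale scale D
    using assms unfolding is_derivation_def by blast
  define g where "g i j = Y ((D ^^ i) a) n ((D ^^ j) b)" for i j
  have Dg: "D (g i j) = g (Suc i) j + g i (Suc j)" for i j
    using assms unfolding is_derivation_def g_def by simp
  have "(D ^^ Suc k) (Y a n b) = (\<Sum>i\<le>k. scale (of_nat (k choose i)) (D (g i (k - i))))"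
    using Suc.IH unfolding g_def by (simp add: D.sum D.scale)
  also have "\<dots> = (\<Sum>i\<le>k. scale (of_nat (k choose i)) (g (Suc i) (k - i)))
      + (\<Sum>i\<le>k. scale (of_nat (k choose i)) (g i (Suc k - i)))"
    unfolding sum.distrib[symmetric]
    by (intro sum.cong refl) (simp add: Dg scale_right_distrib Suc_diff_le)
  also have "(\<Sum>i\<le>k. scale (of_nat (k choose i)) (g i (Suc k - i)))
      = (\<Sum>i\<le>Suc k. scale (of_nat (k choose i)) (g i (Suc k - i)))"
    by simp
  also have "\<dots> = g 0 (Suc k) + (\<Sum>i\<le>k. scale (of_nat (k choose Suc i)) (g (Suc i) (k - i)))"
    by (subst sum.atMost_Suc_shift) simp
  also have "(\<Sum>i\<le>k. scale (of_nat (k choose i)) (g (Suc i) (k - i))) + \<dots>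
      = g 0 (Suc k) + (\<Sum>i\<le>k. scale (of_nat (Suc k choose Suc i)) (g (Suc i) (k - i)))"
    by (simp add: scale_left_distrib sum.distrib)
  also have "\<dots> = (\<Sum>i\<le>Suc k. scale (of_nat (Suc k choose i)) (g i (Suc k - i)))"
    by (subst sum.atMost_Suc_shift) simp
  finally show ?case unfolding g_def .
qed

context
  fixes D :: "'v \<Rightarrow> 'v"
  assumes lin: "Vector_Spaces.linear scale scale D" and nil: "\<And>v. \<exists>N. (D ^^ N) v = 0"
begin

lemma funpow_eq_zero_mono:
  assumes "(D ^^ N) v = 0" "N \<le> M" shows "(D ^^ M) v = 0"
proof -
  have "(D ^^ M) v = (D ^^ (M - N)) ((D ^^ N) v)"
    using assms(2) by (simp add: funpow_add[symmetric, THEN fun_cong, unfolded o_def])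
  thus ?thesis using assms(1) module_hom.zero[OF module_hom_linearI[OF linear_funpow[OF lin]]] by simp
qed

lemma exp_op_eq:
  assumes "(D ^^ N) v = 0"
  shows "exp_op t D v = (\<Sum>i<N. scale (t ^ i / fact i) ((D ^^ i) v))"
  unfolding exp_op_def
  using funpow_eq_zero_mono[OF assms] by (intro sum.mono_neutral_left) (auto simp: not_less intro: ccontr)

lemma linear_exp_op: "Vector_Spaces.linear scale scale (exp_op t D)"
proof -
  have "exp_op t D (u + v) = exp_op t D u + exp_op t D v" for u v
  proof -
    obtain N M where "(D ^^ N) u = 0" "(D ^^ M) v = 0" using nil by blast
    hence 0: "(D ^^ (N + M)) u = 0" "(D ^^ (N + M)) v = 0" by (auto intro: funpow_eq_zero_mono)
    have add: "(D ^^ i) (u + v) = (D ^^ i) u + (D ^^ i) v" for i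
      using linear_funpow[OF lin, of i] by (simp add: Vector_Spaces.linear_iff)
    show ?thesis
      using exp_op_eq[OF 0(1)] exp_op_eq[OF 0(2)] exp_op_eq[of "N + M" "u + v"]
      by (simp add: add 0 scale_right_distrib sum.distrib)
  qed
  moreover have "exp_op t D (scale c v) = scale c (exp_op t D v)" for c v
  proof -
    obtain N where 0: "(D ^^ N) v = 0" using nil by blast
    have sc: "(D ^^ i) (scale c v) = scale c ((D ^^ i) v)" for i
      using linear_funpow[OF lin, of i] by (simp add: Vector_Spaces.linear_iff)
    show ?thesis
      using exp_op_eq[OF 0] exp_op_eq[of N "scale c v"]
      by (simp add: sc 0 scale_sum_right mult.commute)
  qed
  ultimately show ?thesis by (simp add: Vector_Spaces.linear_iff vector_space_axioms)
qed

lemma exp_op_exp_op: "exp_op s D (exp_op t D v) = exp_op (s + t) D v"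
proof -
  obtain N where N: "(D ^^ N) v = 0" using nil by blast
  define g where "g i j = scale (s ^ i / fact i * (t ^ j / fact j)) ((D ^^ (i + j)) v)" for i j
  have N': "(D ^^ N) ((D ^^ j) v) = 0" for j
    using funpow_eq_zero_mono[OF N, of "N + j"] by (simp add: funpow_add)
  interpret e: Vector_Spaces.linear scale scale "exp_op s D" by (rule linear_exp_op)
  have "exp_op s D (exp_op t D v)
      = (\<Sum>j<N. scale (t ^ j / fact j) (exp_op s D ((D ^^ j) v)))"
    unfolding exp_op_eq[OF N, of t] by (simp add: e.sum e.scale)
  also have "\<dots> = (\<Sum>j<N. \<Sum>i<N. g i j)"
    unfolding exp_op_eq[OF N'] g_def by (simp add: scale_sum_right funpow_add mult.commute)
  also have "\<dots> = (\<Sum>i<N. \<Sum>j<N. g i j)" by (rule sum.swap)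
  also have "\<dots> = (\<Sum>k<N + N. \<Sum>i\<le>k. g i (k - i))"
    by (rule sum_triangle_eq_sum_square[symmetric])
      (auto simp: g_def intro: funpow_eq_zero_mono[OF N])
  also have "\<dots> = (\<Sum>k<N + N. scale ((s + t) ^ k / fact k) ((D ^^ k) v))"
  proof (intro sum.cong refl)
    fix k
    have "(\<Sum>i\<le>k. s ^ i / fact i * (t ^ (k - i) / fact (k - i))) = (s + t) ^ k / fact k"
      unfolding binomial_ring sum_divide_distrib
      by (intro sum.cong refl) (simp add: binomial_fact)
    thus "(\<Sum>i\<le>k. g i (k - i)) = scale ((s + t) ^ k / fact k) ((D ^^ k) v)"
      unfolding g_def by (simp add: scale_sum_left[symmetric])
  qed
  also have "\<dots> = exp_op (s + t) D v"
    by (rule exp_op_eq[symmetric]) (auto intro: funpow_eq_zero_mono[OF N])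
  finally show ?thesis .
qed

lemma exp_op_zero: "exp_op 0 D v = v"
proof -
  obtain N where "(D ^^ N) v = 0" using nil by blast
  hence "(D ^^ Suc N) v = 0" by (rule funpow_eq_zero_mono) simp
  thus ?thesis by (simp only: exp_op_eq sum.lessThan_Suc_shift) simp
qed

lemma exp_op_in_Aut:
  assumes der: "is_derivation D"
  shows "exp_op t D \<in> Aut"
proof -
  have "exp_op t D (Y a n b) = Y (exp_op t D a) n (exp_op t D b)" for a n b
  proof -
    obtain N M where N: "(D ^^ N) a = 0" and M: "(D ^^ M) b = 0" using nil by blast
    define g where "g i j = scale (t ^ i / fact i * (t ^ j / fact j)) (Y ((D ^^ i) a) n ((D ^^ j) b))" for i j
    have g0: "i \<ge> N \<Longrightarrow> g i j = 0" "j \<ge> M \<Longrightarrow> g i j = 0" for i j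
      using funpow_eq_zero_mono[OF N] funpow_eq_zero_mono[OF M] by (auto simp: g_def)
    have D0: "(D ^^ (N + M)) (Y a n b) = 0"
      unfolding leibniz[OF der]
    proof (intro sum.neutral ballI)
      fix i
      have "(D ^^ i) a = 0 \<or> (D ^^ (N + M - i)) b = 0"
        using funpow_eq_zero_mono[OF N, of i] funpow_eq_zero_mono[OF M, of "N + M - i"] by linarith
      thus "scale (of_nat (N + M choose i)) (Y ((D ^^ i) a) n ((D ^^ (N + M - i)) b)) = 0" by auto
    qed
    have "exp_op t D (Y a n b) = (\<Sum>k<N + M. \<Sum>i\<le>k. g i (k - i))"
      unfolding exp_op_eq[OF D0] leibniz[OF der] scale_sum_right g_def
    proof (intro sum.cong refl)
      fix k i :: nat assume "i \<in> {..k}"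
      hence i: "i \<le> k" by simp
      hence "t ^ k = t ^ i * t ^ (k - i)" by (simp add: power_add[symmetric])
      hence "t ^ k / fact k * of_nat (k choose i) = t ^ i / fact i * (t ^ (k - i) / fact (k - i))"
        using i by (simp add: binomial_fact)
      thus "scale (t ^ k / fact k) (scale (of_nat (k choose i)) (Y ((D ^^ i) a) n ((D ^^ (k - i)) b)))
        = scale (t ^ i / fact i * (t ^ (k - i) / fact (k - i))) (Y ((D ^^ i) a) n ((D ^^ (k - i)) b))"
        by simp
    qed
    also have "\<dots> = (\<Sum>i<N. \<Sum>j<M. g i j)" by (rule sum_triangle_eq_sum_square) (rule g0; assumption)+
    also have "\<dots> = Y (exp_op t D a) n (exp_op t D b)"
      unfolding exp_op_eq[OF N] exp_op_eq[OF M]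
      by (simp add: g_def Y_sum_left Y_sum_right Y_scale_left Y_scale_right scale_sum_right)
        (subst sum.swap, simp add: mult.commute)
    finally show ?thesis .
  qed
  moreover have "bij (exp_op t D)"
    by (rule o_bij[of "exp_op (- t) D"]) (auto simp: exp_op_exp_op exp_op_zero)
  moreover have "exp_op t D vac = vac"
  proof -
    have "D (Y vac (-1) vac) = Y (D vac) (-1) vac + Y vac (-1) (D vac)"
      using der unfolding is_derivation_def by blast
    hence "(D ^^ 1) vac = 0" by (simp add: creation vacuum)
    thus ?thesis by (simp only: exp_op_eq) simp
  qed
  ultimately show ?thesis unfolding Aut_def using linear_exp_op by blast
qed

end

end

section \<open>Conformal vectors and automorphisms\<close>

context vertex_algebra
begin

text \<open>The eigenspace of $L^a(0) = a(1)$ for the integer eigenvalue \<open>n\<close>.\<close>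

definition eigenspace :: "'v \<Rightarrow> int \<Rightarrow> 'v set" where
  "eigenspace a n = {v. Y a 1 v = scale (of_int n) v}"

text \<open>
  The properties of a conformal vector of strong CFT type on which the conjugacy argument rests:
  $a(1)$ is diagonalisable with integer eigenvalues, $a(0) = T$, \<open>a\<close> has degree 2 in the grading
  that it defines, and $L^a(1) = a(2)$ vanishes on vectors of degree 1. The Virasoro relations,
  positivity and finite dimensionality are not part of this notion.
\<close>

definition strong_grading_vector :: "'v \<Rightarrow> bool" where
  "strong_grading_vector a \<longleftrightarrow> graded_space scale (eigenspace a) \<and>
     (\<forall>v. Y a 0 v = T v) \<and> Y a 1 a = scale 2 a \<and> (\<forall>v. Y a 1 v = v \<longrightarrow> Y a 2 v = 0)"

lemma CV_sCFT_imp_strong_grading_vector: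
  assumes "a \<in> CV_sCFT" shows "strong_grading_vector a"
proof -
  interpret A: strong_CFT_VOA scale Y vac "eigenspace a" a
    using assms unfolding CV_sCFT_def eigenspace_def by simp
  show ?thesis
    unfolding strong_grading_vector_def
  proof (intro conjI allI impI)
    show "graded_space scale (eigenspace a)" by (rule A.graded_space_axioms)
    show "Y a 0 v = T v" for v by (rule A.L_minus1)
    show "Y a 1 a = scale 2 a" using A.L0_grade[OF A.omega_grade] by simp
    show "Y a 2 v = 0" if "Y a 1 v = v" for v
      by (rule A.L1_grade_one) (simp add: eigenspace_def that)
  qed
qed

lemma strong_grading_vector_Aut:
  assumes a: "strong_grading_vector a" and f: "f \<in> Aut"
  shows "strong_grading_vector (f a)"
proof -
  have lin: "Vector_Spaces.linear scale scale f" and bij: "bij f"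
    and fY: "\<And>a n b. f (Y a n b) = Y (f a) n (f b)" and fvac: "f vac = vac"
    using f unfolding Aut_def by auto
  interpret f: Vector_Spaces.linear scale scale f by (rule lin)
  have eq: "f u = f v \<longleftrightarrow> u = v" for u v using bij by (metis bij_is_inj injD)
  have surj: "\<exists>u. v = f u" for v using bij by (metis bij_pointE)
  have "f ` eigenspace a n = eigenspace (f a) n" for n
  proof -
    have "f u \<in> eigenspace (f a) n \<longleftrightarrow> u \<in> eigenspace a n" for u
      unfolding eigenspace_def by (simp add: fY[symmetric] f.scale[symmetric] eq)
    moreover have "\<exists>u. v = f u" for v by (rule surj)
    ultimately show ?thesis by fast
  qed
  hence "eigenspace (f a) = (\<lambda>n. f ` eigenspace a n)" by auto
  moreover have "graded_space scale (\<lambda>n. f ` eigenspace a n)"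
    using a lin bij unfolding strong_grading_vector_def by (blast intro: graded_space.graded_space_image)
  moreover have "Y (f a) 0 v = T v" for v
  proof -
    obtain u where u: "v = f u" using surj by blast
    have "Y (f a) 0 v = f (T u)" using a unfolding strong_grading_vector_def u fY[symmetric] by simp
    thus ?thesis unfolding T_def fY fvac u .
  qed
  moreover have "Y (f a) 1 (f a) = scale 2 (f a)"
    using a unfolding strong_grading_vector_def by (simp add: fY[symmetric] f.scale[symmetric])
  moreover have "Y (f a) 2 v = 0" if "Y (f a) 1 v = v" for v
  proof -
    obtain u where u: "v = f u" using surj by blast
    have "Y a 1 u = u" using that unfolding u fY[symmetric] eq .
    hence "Y a 2 u = 0" using a unfolding strong_grading_vector_def by blast
    thus ?thesis unfolding u fY[symmetric] by simp
  qed
  ultimately show ?thesis unfolding strong_grading_vector_def by simp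
qed

lemma eigenspace_product:
  assumes a: "strong_grading_vector a" and u: "u \<in> eigenspace a i" and v: "v \<in> eigenspace a j"
  shows "Y u n v \<in> eigenspace a (i + j - n - 1)"
proof -
  have "Y a 1 (Y u n v) = Y u n (Y a 1 v) + (Y (Y a 0 u) (n + 1) v + Y (Y a 1 u) n v)"
    using commutator_1[of a u n v] by (simp add: algebra_simps)
  also have "Y a 0 u = T u" using a unfolding strong_grading_vector_def by blast
  also have "Y a 1 u = scale (of_int i) u" using u unfolding eigenspace_def by blast
  also have "Y a 1 v = scale (of_int j) v" using v unfolding eigenspace_def by blast
  finally show ?thesis
    unfolding eigenspace_def
    by (simp add: Y_T Y_scale_left Y_scale_right scale_left_distrib scale_left_diff_distrib)
qed

lemma Aut_comp: "f \<in> Aut \<Longrightarrow> g \<in> Aut \<Longrightarrow> (\<lambda>v. f (g v)) \<in> Aut"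
  unfolding Aut_def using linear_comp[of f g] bij_comp[of g f] by (auto simp: o_def)

end

context strong_CFT_VOA
begin

lemma proj_omega: "proj n \<omega> = (if n = 2 then \<omega> else 0)"
  using omega_grade proj_other[OF omega_grade] by auto

text \<open>The difference $x = a - \omega$ satisfies $x(0) = T - T = 0$, and so do its components.\<close>

lemma component_zero_mode:
  assumes "strong_grading_vector a"
  shows "n \<noteq> 2 \<Longrightarrow> Y (proj n a) 0 v = 0"
    and "k \<ge> 2 \<Longrightarrow> \<exists>w \<in> V (k - 1). proj k a = (if k = 2 then \<omega> else 0) + T w"
proof -
  have "Y (a - \<omega>) 0 v = 0" for v
    using assms unfolding strong_grading_vector_def by (simp add: Y_diff_left L_minus1)
  hence 0: "Y (proj n (a - \<omega>)) 0 v = 0" for n v by (rule Y_proj_eq_zero)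
  have eq: "proj n a = proj n \<omega> + proj n (a - \<omega>)" for n by (simp add: proj_diff)
  show "n \<noteq> 2 \<Longrightarrow> Y (proj n a) 0 v = 0" using 0 by (simp add: eq proj_omega)
  assume "k \<ge> 2"
  hence "k \<noteq> 0" "k \<noteq> 1" by auto
  from zero_mode_vanishes_imp_in_range_T[OF proj_in this 0]
  obtain w where "w \<in> V (k - 1)" "proj k (a - \<omega>) = T w" .
  thus "\<exists>w \<in> V (k - 1). proj k a = (if k = 2 then \<omega> else 0) + T w"
    unfolding eq proj_omega by auto
qed

lemma derivation_one_mode:
  assumes h0: "\<And>v. Y h 0 v = 0"
  shows "is_derivation (Y h 1)"
  unfolding is_derivation_def
proof (intro conjI allI)
  fix a n b
  show "Y h 1 (Y a n b) = Y (Y h 1 a) n b + Y a n (Y h 1 b)"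
    using commutator_1[of h a n b] by (simp add: h0 algebra_simps)
qed (rule linear_right)

lemma funpow_one_mode_grade:
  assumes h: "h \<in> V 1" and v: "v \<in> V n"
  shows "(Y h 1 ^^ i) v \<in> V (n - int i)"
proof (induction i)
  case 0
  show ?case using v by simp
next
  case (Suc i)
  have "Y h 1 ((Y h 1 ^^ i) v) \<in> V (n - int (Suc i))"
    by (rule grade_product_eq[OF h Suc.IH]) simp
  thus ?case by simp
qed

lemma proj_funpow_one_mode:
  assumes h: "h \<in> V 1"
  shows "proj k ((Y h 1 ^^ i) v) = (Y h 1 ^^ i) (proj (k + int i) v)"
proof (induction i arbitrary: k)
  case 0
  show ?case by simp
next
  case (Suc i)
  have "proj k ((Y h 1 ^^ Suc i) v) = Y h 1 (proj (k + 1) ((Y h 1 ^^ i) v))"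
    using proj_Y_left[OF h, of k 1] by simp
  also have "\<dots> = (Y h 1 ^^ Suc i) (proj (k + 1 + int i) v)" by (simp add: Suc.IH)
  also have "k + 1 + int i = k + int (Suc i)" by simp
  finally show ?case .
qed

lemma locally_nilpotent_one_mode:
  assumes h: "h \<in> V 1"
  shows "\<exists>N. (Y h 1 ^^ N) v = 0"
proof -
  define N where "N = nat (Max (insert 0 {n. proj n v \<noteq> 0}) + 1)"
  have M: "n < int N" if "proj n v \<noteq> 0" for n
    using Max_ge[of "insert 0 {n. proj n v \<noteq> 0}" n] that unfolding N_def by auto
  have "proj k ((Y h 1 ^^ N) v) = 0" for k
  proof (cases "k < 0")
    case False
    hence "proj (k + int N) v = 0" using M[of "k + int N"] by fastforce
    thus ?thesis
      unfolding proj_funpow_one_mode[OF h]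
      using module_hom.zero[OF module_hom_linearI[OF linear_funpow[OF linear_right]]] by simp
  qed (rule proj_neg)
  hence "(Y h 1 ^^ N) v = 0" by (rule eq_zeroI_proj)
  thus ?thesis by blast
qed

lemma one_mode_omega:
  assumes h: "h \<in> V 1"
  shows "Y h 1 \<omega> = h"
proof -
  have "Y (Y \<omega> (1 + int i) h) (- 1 - int i) vac = 0" if "i \<noteq> 0" for i
  proof (cases "i = 1")
    case True
    thus ?thesis using L1_grade_one[OF h] by simp
  next
    case False
    have "Y \<omega> (1 + int i) h \<in> V (1 - int i)"
      by (rule grade_product_eq[OF omega_grade h]) simp
    hence "Y \<omega> (1 + int i) h = 0" using that False by (intro grade_neg_eq_zero) auto
    thus ?thesis by simp
  qed
  hence "Sum_any (\<lambda>i. scale ((-1) ^ i) (Y (Y \<omega> (1 + int i) h) (- 1 - int i) vac))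
      = (\<Sum>i\<in>{0}. scale ((-1) ^ i) (Y (Y \<omega> (1 + int i) h) (- 1 - int i) vac))"
    by (intro Sum_any.expand_superset) auto
  thus ?thesis
    using skew_symmetry[of 1 h \<omega>] L0_grade[OF h] by (simp add: creation)
qed

text \<open>
  Put $D = h(1)$ with $h = a_1$. The degree 1 component of $\exp(-D)a$ is
  $\sum_i (-1)^i D^i a_{1+i} / i!$, in which the two terms $h$ and $-D\omega = -h$ cancel. All
  others are of the form $D^i T w = T D^i w$ with $D^i w \in V_0$, hence zero.
\<close>

lemma remove_degree_one:
  assumes a: "strong_grading_vector a"
  obtains f where "f \<in> Aut" "proj 1 (f a) = 0"
proof -
  define h where "h = proj 1 a"
  have h: "h \<in> V 1" by (simp add: h_def)
  have h0: "Y h 0 v = 0" for v unfolding h_def by (rule component_zero_mode[OF a]) simp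
  define D where "D = Y h 1"
  interpret D: Vector_Spaces.linear scale scale D unfolding D_def by (rule linear_right)
  have lin: "Vector_Spaces.linear scale scale D" by (rule D.linear_axioms)
  have nil: "\<exists>N. (D ^^ N) v = 0" for v unfolding D_def by (rule locally_nilpotent_one_mode[OF h])
  have der: "is_derivation D" unfolding D_def by (rule derivation_one_mode[OF h0])
  have DT: "(D ^^ i) (T w) = T ((D ^^ i) w)" for i w
  proof (induction i)
    case (Suc i)
    have "D (T ((D ^^ i) w)) = T (D ((D ^^ i) w))"
      unfolding D_def T_product by (simp add: Y_T h0)
    thus ?case using Suc.IH by simp
  qed simp
  have DTw: "(D ^^ i) (T w) = 0" if "w \<in> V (int i)" for i w
  proof -
    have "(D ^^ i) w \<in> V 0" using funpow_one_mode_grade[OF h that, of i] unfolding D_def by simp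
    thus ?thesis unfolding DT by (rule T_grade_zero)
  qed
  have high: "(D ^^ i) (proj (1 + int i) a) = (if i = 0 \<or> i = 1 then h else 0)" for i
  proof (cases "i = 0")
    case True
    thus ?thesis by (simp add: h_def)
  next
    case False
    then obtain w where w: "w \<in> V (1 + int i - 1)"
        "proj (1 + int i) a = (if 1 + int i = 2 then \<omega> else 0) + T w"
      using component_zero_mode(2)[OF a, of "1 + int i"] by auto
    have lini: "(D ^^ i) (u + v) = (D ^^ i) u + (D ^^ i) v" "(D ^^ i) 0 = 0" for u v
      using module_hom.add[OF module_hom_linearI[OF linear_funpow[OF lin]]]
        module_hom.zero[OF module_hom_linearI[OF linear_funpow[OF lin]]] by auto
    have "(D ^^ i) (T w) = 0" using w(1) by (intro DTw) simp
    moreover have "D \<omega> = h" unfolding D_def by (rule one_mode_omega[OF h])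
    ultimately show ?thesis
      using False unfolding w(2) lini by (cases "i = 1") (auto simp: lini)
  qed
  \<comment> \<open>At least two summands are kept, for those with index 0 and 1 cancel.\<close>
  obtain N where "(D ^^ N) a = 0" using nil by blast
  hence N: "(D ^^ Suc (Suc N)) a = 0" by (rule funpow_eq_zero_mono[OF lin nil]) simp
  have "proj 1 (exp_op (-1) D a)
    = (\<Sum>i<Suc (Suc N). scale ((-1) ^ i / fact i) ((D ^^ i) (proj (1 + int i) a)))"
    unfolding exp_op_eq[OF lin nil N]
    by (simp only: proj_sum_distrib proj_scale proj_funpow_one_mode[OF h] D_def)
  also have "\<dots> = 0"
    unfolding high by (simp add: sum.lessThan_Suc_shift del: sum.lessThan_Suc)
  finally show thesis by (rule that[OF exp_op_in_Aut[OF lin nil der]])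
qed

text \<open>
  Let $a_2 = \omega + Tv$ with $v \in V_1$. Up to terms of higher degree, $a(1)$ is $L(0) - v(0)$ and
  $a(2)$ is $L(1) - 2v(1)$. If $v \ne 0$, then $v(1)\beta \ne 0$ for some $\beta \in V_1$, which is
  a sum of eigenvectors of $a(1)$. The degree 1 component of an eigenvector for the eigenvalue $m$
  is an eigenvector of $v(0)$ for $1 - m$. It is killed by $v(1)$: for $m \ne 1$ because
  $v(1)v(0) = 0$ on $V_1$, and for $m = 1$ because $a(2)$ kills the eigenvector.
\<close>

lemma lowest_component_is_omega:
  assumes simple: "is_simple" and a: "strong_grading_vector a" and a1: "proj 1 a = 0"
  shows "proj 2 a = \<omega>" and "i < 2 \<Longrightarrow> proj i a = 0"
proof -
  interpret E: graded_space scale "eigenspace a"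
    using a unfolding strong_grading_vector_def by blast
  \<comment> \<open>Vectors of $V_0$ are multiples of the vacuum, so they do not contribute to modes of index
    at least 0.\<close>
  define a' where "a' = a - proj 0 a"
  have Ya: "Y a n y = Y a' n y" if "n \<ge> 0" for n y
    using Y_nonneg_grade_zero(2)[OF proj_in that] by (simp add: a'_def Y_diff_left)
  have a'0: "proj i a' = 0" if "i < 2" for i
  proof -
    consider "i < 0" | "i = 0" | "i = 1" using \<open>i < 2\<close> by linarith
    thus ?thesis
      using proj_neg[of i] a1 proj_other[OF proj_in, of 1 0 a] by cases (auto simp: a'_def proj_diff)
  qed
  have a'2: "proj 2 a' = proj 2 a"
    using proj_other[OF proj_in, of 2 0 a] by (simp add: a'_def proj_diff)
  have L0_0: "proj 0 (Y a 1 y) = 0" for y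
    using proj_Y_lowest(1)[of 2 a' 0 y 1, OF a'0 proj_neg] Y_nonneg_grade_zero(1)[OF proj_in, of 1]
    by (simp add: Ya)
  have "Y a 1 a = scale 2 a" using a unfolding strong_grading_vector_def by blast
  hence "proj 0 a = 0" using L0_0[of a] by (simp add: proj_scale)
  thus "proj i a = 0" if "i < 2" for i
    using a'0[OF that] unfolding a'_def by (simp add: proj_diff)
  have low: "proj (2 - n) (Y a n y) = Y (proj 2 a) n (proj 1 y)" if "n \<ge> 0" for n y
  proof -
    have "proj j (y - proj 0 y) = 0" if "j < 1" for j
      using that proj_neg[of j] by (cases "j = 0") (auto simp: proj_diff)
    from proj_Y_lowest(1)[of 2 a' 1 "y - proj 0 y" n, OF a'0 this]
    show ?thesis
      using Y_nonneg_grade_zero(1)[OF proj_in that] proj_other[OF proj_in, of 1 0 y]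
      by (simp add: Ya that Y_diff_right proj_diff a'2)
  qed
  obtain v where v: "v \<in> V 1" and a2: "proj 2 a = \<omega> + T v"
    using component_zero_mode(2)[OF a, of 2] by auto
  have v0v: "Y v 0 v = 0"
  proof -
    have "scale 2 (Y v 0 v) \<in> range T"
      using skew_symmetry_mod_T[of 0 v v] scale_left_distrib[of 1 1 "Y v 0 v"] by simp
    hence "Y v 0 v \<in> range T" by (rule subspace_scale_cancel[OF subspace_range_T]) simp
    then obtain z where z: "Y v 0 v = T z" by blast
    have "Y v 0 v \<in> V 1" by (rule grade_product_eq[OF v v]) simp
    thus ?thesis using proj_T[of 1 z] T_grade_zero[OF proj_in] unfolding z[symmetric] by simp
  qed
  have v1v0: "Y v 1 (Y v 0 z) = 0" if z: "z \<in> V 1" for z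
  proof -
    have "Y v 1 z \<in> V 0" by (rule grade_product_eq[OF v z]) simp
    hence "Y v 0 (Y v 1 z) = 0" by (rule Y_nonneg_grade_zero) simp
    thus ?thesis using commutator_0[of v v 1 z] v0v by simp
  qed
  show "proj 2 a = \<omega>"
  proof (rule ccontr)
    assume "proj 2 a \<noteq> \<omega>"
    hence "v \<noteq> 0" using a2 module_hom.zero[OF module_hom_linearI[OF linear_T]] by auto
    then obtain \<beta> where \<beta>: "\<beta> \<in> V 1" "Y v 1 \<beta> \<noteq> 0"
      using nondegenerate_degree_one[OF simple v] by blast
    have zero: "Y v 1 (proj 1 (E.proj m \<beta>)) = 0" for m
    proof -
      define b where "b = E.proj m \<beta>"
      have b: "Y a 1 b = scale (of_int m) b"
        using E.proj_in[of m \<beta>] unfolding b_def eigenspace_def by blast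
      show ?thesis
      proof (cases "m = 1")
        case True
        hence "Y a 1 b = b" using b by simp
        hence "Y a 2 b = 0" using a unfolding strong_grading_vector_def by blast
        hence "Y (T v) 2 (proj 1 b) = 0"
          using low[of 2 b] L1_grade_one[OF proj_in] by (simp add: a2 Y_add_left)
        thus ?thesis by (simp add: Y_T b_def)
      next
        case False
        have "proj 1 (Y a 1 b) = proj 1 b - Y v 0 (proj 1 b)"
          using low[of 1 b] L0_grade[OF proj_in, of 1 b] by (simp add: a2 Y_add_left Y_T)
        hence "Y v 0 (proj 1 b) = scale (of_int (1 - m)) (proj 1 b)"
          unfolding b proj_scale by (simp add: scale_left_diff_distrib)
        hence "scale (of_int (1 - m)) (Y v 1 (proj 1 b)) = 0"
          using v1v0[OF proj_in, of b] by (simp only: Y_scale_right)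
        moreover have "of_int (1 - m) \<noteq> (0 :: 'k)"
          using False by (simp only: of_int_eq_0_iff)
        ultimately show ?thesis unfolding b_def[symmetric] by (simp only: scale_eq_0_iff) simp
      qed
    qed
    have "Y v 1 \<beta> = Y v 1 (proj 1 (\<Sum>m | E.proj m \<beta> \<noteq> 0. E.proj m \<beta>))"
      using \<beta>(1) by (simp add: E.proj_sum)
    also have "\<dots> = (\<Sum>m | E.proj m \<beta> \<noteq> 0. Y v 1 (proj 1 (E.proj m \<beta>)))"
      by (simp only: proj_sum_distrib Y_sum_right)
    finally show False using \<beta>(2) zero by simp
  qed
qed

text \<open>
  The hypotheses say that $a(1)$ and $L(0)$ differ by an operator that raises the degree. Hence an
  eigenvector of $a(1)$ for the eigenvalue $m$ has its lowest component in degree $m$, and the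
  automorphism sends it to that component.
\<close>

lemma exists_automorphism_lowest_component:
  assumes a: "strong_grading_vector a" and a2: "proj 2 a = \<omega>" and low: "\<And>i. i < 2 \<Longrightarrow> proj i a = 0"
  obtains f where "f \<in> Aut" "f a = \<omega>"
proof -
  interpret E: graded_space scale "eigenspace a"
    using a unfolding strong_grading_vector_def by blast
  define f where "f v = (\<Sum>m | E.proj m v \<noteq> 0. proj m (E.proj m v))" for v
  have f_eq: "f v = (\<Sum>m\<in>S. proj m (E.proj m v))"
    if "finite S" "{m. E.proj m v \<noteq> 0} \<subseteq> S" for S v
    unfolding f_def using that by (intro sum.mono_neutral_left) auto
  have lead: "(\<forall>k<m. proj k b = 0) \<and> (b \<noteq> 0 \<longrightarrow> proj m b \<noteq> 0)" if b: "b \<in> eigenspace a m" for b m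
  proof (cases "b = 0")
    case False
    then obtain d where d: "proj d b \<noteq> 0" "\<And>k. k < d \<Longrightarrow> proj k b = 0"
      by (rule least_degree) blast
    have "scale (of_int m) (proj d b) = proj d (Y a 1 b)"
      using b unfolding eigenspace_def by (simp add: proj_scale)
    also have "\<dots> = Y \<omega> 1 (proj d b)"
      using proj_Y_lowest(1)[of 2 a d b 1, OF low d(2)] by (simp add: a2)
    also have "\<dots> = scale (of_int d) (proj d b)" by (rule L0_grade[OF proj_in])
    finally have "m = d" using d(1) by simp
    thus ?thesis using d by blast
  qed simp
  have lin: "Vector_Spaces.linear scale scale f"
  proof -
    have "f (u + v) = f u + f v" for u v
    proof -
      let ?S = "{m. E.proj m u \<noteq> 0} \<union> {m. E.proj m v \<noteq> 0}"
      have "f (u + v) = (\<Sum>m\<in>?S. proj m (E.proj m (u + v)))"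
        by (rule f_eq) (auto simp: E.proj_add)
      also have "\<dots> = (\<Sum>m\<in>?S. proj m (E.proj m u)) + (\<Sum>m\<in>?S. proj m (E.proj m v))"
        by (simp add: E.proj_add proj_add sum.distrib)
      also have "\<dots> = f u + f v" using f_eq[of ?S u] f_eq[of ?S v] by simp
      finally show ?thesis .
    qed
    moreover have "f (scale c v) = scale c (f v)" for c v
    proof -
      have "f (scale c v) = (\<Sum>m | E.proj m v \<noteq> 0. proj m (E.proj m (scale c v)))"
        by (rule f_eq) (auto simp: E.proj_scale)
      thus ?thesis by (simp add: f_def E.proj_scale proj_scale scale_sum_right)
    qed
    ultimately show ?thesis by (simp add: Vector_Spaces.linear_iff vector_space_axioms)
  qed
  interpret f: Vector_Spaces.linear scale scale f by (rule lin)
  have f_on: "f v = proj m v" if "v \<in> eigenspace a m" for v m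
    using f_eq[of "{m}" v] E.proj_other[OF that] E.proj_same[OF that] by auto
  have fY: "f (Y u n v) = Y (f u) n (f v)" for u n v
  proof (rule E.linear_eqI[where f = "\<lambda>u. f (Y u n v)"])
    show "Vector_Spaces.linear scale scale (\<lambda>u. f (Y u n v))"
      by (rule linear_comp[OF lin linear_left])
    show "Vector_Spaces.linear scale scale (\<lambda>u. Y (f u) n (f v))"
      by (rule linear_comp[OF linear_left lin])
    fix i u assume u: "u \<in> eigenspace a i"
    show "f (Y u n v) = Y (f u) n (f v)"
    proof (rule E.linear_eqI[where f = "\<lambda>v. f (Y u n v)"])
      show "Vector_Spaces.linear scale scale (\<lambda>v. f (Y u n v))"
        by (rule linear_comp[OF lin linear_right])
      show "Vector_Spaces.linear scale scale (\<lambda>v. Y (f u) n (f v))"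
        by (rule linear_comp[OF linear_right lin])
      fix j v assume v: "v \<in> eigenspace a j"
      have "f (Y u n v) = proj (i + j - n - 1) (Y u n v)"
        by (rule f_on[OF eigenspace_product[OF a u v]])
      also have "\<dots> = Y (proj i u) n (proj j v)"
        using lead[OF u] lead[OF v] by (intro proj_Y_lowest(1)) auto
      finally show "f (Y u n v) = Y (f u) n (f v)" unfolding f_on[OF u] f_on[OF v] .
    qed
  qed
  have "vac \<in> eigenspace a 0" unfolding eigenspace_def by (simp add: creation_nonneg)
  hence fvac: "f vac = vac" using f_on vac_grade by simp
  have proj_f: "proj m (f v) = proj m (E.proj m v)" for m v
    by (rule proj_eqI[of "\<lambda>m. proj m (E.proj m v)" "{m. E.proj m v \<noteq> 0}"]) (auto simp: f_def)
  have inj: "inj f"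
    unfolding f.inj_iff_eq_0
  proof (intro allI impI)
    fix v assume "f v = 0"
    hence "proj m (E.proj m v) = 0" for m using proj_f[of m v] by simp
    hence "E.proj m v = 0" for m using lead[OF E.proj_in, of m v] by blast
    thus "v = 0" by (rule E.eq_zeroI_proj)
  qed
  have proj_split: "proj k u = (\<Sum>m | E.proj m u \<noteq> 0. proj k (E.proj m u))" for k u
    unfolding proj_sum_distrib[symmetric] by (simp add: E.proj_sum)
  have homogeneous: "f (E.proj n u) = u" if u: "u \<in> V n" for n u
  proof (cases "u = 0")
    case True
    thus ?thesis by simp
  next
    case False
    then obtain d where d: "E.proj d u \<noteq> 0" "\<And>k. k < d \<Longrightarrow> E.proj k u = 0"
      by (rule E.least_degree) blast
    have single: "proj k u = proj k (E.proj k u)" if "\<And>m. m < k \<Longrightarrow> E.proj m u = 0" for k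
    proof -
      have "proj k u = (\<Sum>m | E.proj m u \<noteq> 0. if m = k then proj k (E.proj k u) else 0)"
        unfolding proj_split[of k u]
      proof (intro sum.cong refl)
        fix m assume "m \<in> {m. E.proj m u \<noteq> 0}"
        hence "k \<le> m" using that[of m] by force
        thus "proj k (E.proj m u) = (if m = k then proj k (E.proj k u) else 0)"
          using lead[OF E.proj_in, of m u] by auto
      qed
      thus ?thesis by auto
    qed
    have "proj d u \<noteq> 0" using single[OF d(2)] lead[OF E.proj_in, of d u] d(1) by metis
    hence "d = n" using proj_other[OF u] by blast
    thus ?thesis using single[of n] d(2) f_on[OF E.proj_in, of n u] u by simp
  qed
  have "u \<in> range f" for u
  proof -
    have "f (\<Sum>n | proj n u \<noteq> 0. E.proj n (proj n u)) = u"
      by (simp add: f.sum homogeneous[OF proj_in] proj_sum)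
    thus ?thesis by (rule range_eqI[OF sym])
  qed
  hence "bij f" using inj by (auto simp: bij_def)
  hence "f \<in> Aut" unfolding Aut_def using lin fY fvac by blast
  moreover have "a \<in> eigenspace a 2"
    using a unfolding eigenspace_def strong_grading_vector_def by simp
  hence "f a = \<omega>" using f_on a2 by simp
  ultimately show thesis by (rule that)
qed

lemma strong_grading_vector_conjugate:
  assumes "is_simple" "strong_grading_vector a"
  shows "\<exists>f \<in> Aut. f a = \<omega>"
proof -
  obtain g where g: "g \<in> Aut" "proj 1 (g a) = 0" using remove_degree_one[OF assms(2)] .
  have ga: "strong_grading_vector (g a)" using strong_grading_vector_Aut[OF assms(2) g(1)] .
  obtain f where f: "f \<in> Aut" "f (g a) = \<omega>"
    using exists_automorphism_lowest_component[OF ga lowest_component_is_omega[OF assms(1) ga g(2)]] .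
  show ?thesis by (rule bexI[OF _ Aut_comp[OF f(1) g(1)]]) (rule f(2))
qed

end

section \<open>Conjugacy of conformal vectors of strong CFT type\<close>

theorem theorem5p1:
  fixes scale :: "'k::real_or_complex \<Rightarrow> 'v::ab_group_add \<Rightarrow> 'v"
    and Y :: "'v \<Rightarrow> int \<Rightarrow> 'v \<Rightarrow> 'v"
    and vac :: 'v
    and V :: "int \<Rightarrow> 'v set"
    and \<omega> :: 'v
  assumes "strong_CFT_VOA scale Y vac V \<omega>"
    and "vertex_algebra.is_simple scale Y"
  shows "\<forall>a \<in> vertex_algebra.CV_sCFT scale Y vac. \<forall>b \<in> vertex_algebra.CV_sCFT scale Y vac.
           \<exists>f \<in> vertex_algebra.Aut scale Y vac. f a = b"
proof (intro ballI)
  interpret W: strong_CFT_VOA scale Y vac V \<omega> by (rule assms(1))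
  fix a b assume a: "a \<in> W.CV_sCFT" and b: "b \<in> W.CV_sCFT"
  interpret B: strong_CFT_VOA scale Y vac "\<lambda>n. {v. Y b 1 v = scale (of_int n) v}" b
    using b unfolding W.CV_sCFT_def by blast
  show "\<exists>f \<in> W.Aut. f a = b"
    by (rule B.strong_grading_vector_conjugate[OF assms(2) W.CV_sCFT_imp_strong_grading_vector[OF a]])
qed

end
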